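(* For every integer $n\ge 1$, the denominator $\alpha_{n,j}$ (in reduced form) of the rational number $B_n^*(j)$ does not depend on the value $j\in\mathbb{Z}$.
   Context: The Bernoulli polynomials $B_r(x)$ are defined by $\frac{te^{xt}}{e^t-1}=\sum_{r\ge 0} B_r(x)\frac{t^r}{r!}$. For $n\ge 1$ the Zagier polynomials are $B_n^*(x)=\sum_{r=0}^n \binom{n+r}{2r}\frac{B_r(x)}{n+r}$. *)

theory Defs
  imports Complex_Main "HOL-Computational_Algebra.Formal_Power_Series"
begin

text \<open>
  The Bernoulli polynomials are represented by their values: for each fixed \<open>x\<close>,
  the generating function \<open>t e\<^sup>x\<^sup>t / (e\<^sup>t - 1)\<close> is a formal power series in \<open>t\<close> over the field
  containing \<open>x\<close>. The divisor \<open>e\<^sup>t - 1\<close> has subdegree 1, so the quotient is exact.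
\<close>

definition bernoulli_gf :: "'a::field_char_0 \<Rightarrow> 'a fps" where
  "bernoulli_gf x = fps_X * fps_exp x / (fps_exp 1 - 1)"

definition bernoulli_poly :: "nat \<Rightarrow> 'a::field_char_0 \<Rightarrow> 'a" where
  "bernoulli_poly r x = fact r * fps_nth (bernoulli_gf x) r"

lemma bernoulli_poly_generating_function:
  fixes x :: "'a::field_char_0"
  shows "Abs_fps (\<lambda>r. bernoulli_poly r x / fact r) * (fps_exp 1 - 1) = fps_X * fps_exp x"
proof -
  have nz: "fps_nth (fps_exp 1 - 1 :: 'a fps) 1 \<noteq> 0"
    by simp
  then have "fps_exp 1 - 1 \<noteq> (0 :: 'a fps)"
    by (metis fps_zero_nth)
  moreover have "subdegree (fps_exp 1 - 1 :: 'a fps) \<le> subdegree (fps_X * fps_exp x)"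
  proof -
    have "subdegree (fps_exp 1 - 1 :: 'a fps) \<le> 1"
      using nz by (rule subdegree_leI)
    moreover have "fps_nth (fps_X * fps_exp x) 1 \<noteq> 0"
      by simp
    then have "fps_X * fps_exp x \<noteq> 0"
      by (metis fps_zero_nth)
    then have "1 \<le> subdegree (fps_X * fps_exp x)"
      by (intro subdegree_geI) auto
    ultimately show ?thesis
      by linarith
  qed
  moreover have "fps_X * fps_exp x \<noteq> 0"
    by (metis fps_X_neq_zero fps_exp_neq_0 mult_eq_0_iff)
  ultimately have "(fps_exp 1 - 1) dvd fps_X * fps_exp x"
    by (simp add: fps_dvd_iff)
  moreover have "Abs_fps (\<lambda>r. bernoulli_poly r x / fact r) = bernoulli_gf x"
    by (simp add: fps_eq_iff bernoulli_poly_def)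
  ultimately show ?thesis
    by (simp add: bernoulli_gf_def)
qed

text \<open>For \<open>n = 0\<close> the defining formula is meaningless (its \<open>r = 0\<close> term divides by zero).\<close>

definition zagier_poly :: "nat \<Rightarrow> 'a::field_char_0 \<Rightarrow> 'a" where
  "zagier_poly n x = (\<Sum>r=0..n. of_nat ((n + r) choose (2 * r)) * (bernoulli_poly r x / of_nat (n + r)))"

definition zagier_denom :: "nat \<Rightarrow> int \<Rightarrow> int" where
  "zagier_denom n j = snd (quotient_of (zagier_poly n (of_int j)))"

end

theory Submission
  imports Defs "HOL-Number_Theory.Fib"
begin

text \<open>
  Since \<open>B\<^sub>r(x + 1) - B\<^sub>r(x) = r x\<^bsup>r-1\<^esup>\<close>, we have
  \<open>2 (B\<^sub>n\<^sup>*(j + 1) - B\<^sub>n\<^sup>*(j)) = \<Sum>\<^sub>r (n+r-1 choose 2r-1) j\<^bsup>r-1\<^esup>\<close>, an integer.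
  Adding an integer does not change a denominator, and adding a half-integer does not change a
  denominator divisible by 4. The right-hand side is congruent modulo 2 to \<open>n\<close> for \<open>j\<close> even and to
  the Fibonacci number \<open>F\<^bsub>2n\<^esub>\<close> for \<open>j\<close> odd, so it is always even if 6 divides \<open>n\<close>. If 6 does not
  divide \<open>n\<close>, then 4 divides the denominator of \<open>B\<^sub>n\<^sup>*(0)\<close>: in \<open>4n B\<^sub>n\<^sup>*(0) = \<Sum>\<^sub>r c\<^sub>r 2B\<^sub>r\<close> the
  coefficients \<open>c\<^sub>r\<close> are integers, and the numbers \<open>2B\<^sub>r\<close> are 2-adic integers of known parity, so
  that \<open>4n B\<^sub>n\<^sup>*(0)\<close> turns out to be a 2-adic unit.
\<close>

section \<open>Bernoulli polynomials\<close>

lemma bernoulli_gf_mult: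
  "bernoulli_gf x * (fps_exp 1 - 1) = fps_X * fps_exp (x::'a::field_char_0)"
proof -
  have "Abs_fps (\<lambda>r. bernoulli_poly r x / fact r) = bernoulli_gf x"
    by (simp add: fps_eq_iff bernoulli_poly_def)
  then show ?thesis
    using bernoulli_poly_generating_function[of x] by simp
qed

lemma fps_exp_1_minus_1_nonzero: "fps_exp 1 - 1 \<noteq> (0 :: 'a::field_char_0 fps)"
proof
  assume "fps_exp 1 - 1 = (0 :: 'a fps)"
  then have "fps_nth (fps_exp 1 - 1 :: 'a fps) 1 = fps_nth 0 1" by metis
  then show False by simp
qed

text \<open>Since \<open>fps_exp (x + 1) - fps_exp x = fps_exp x * (fps_exp 1 - 1)\<close>, the
  nonzero factor \<open>fps_exp 1 - 1\<close> cancels.\<close>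

lemma bernoulli_gf_plus_1:
  "bernoulli_gf (x + 1) - bernoulli_gf x = fps_X * fps_exp (x::'a::field_char_0)"
proof -
  have "(bernoulli_gf (x + 1) - bernoulli_gf x) * (fps_exp 1 - 1) =
        fps_X * fps_exp x * (fps_exp 1 - 1)"
    by (simp only: left_diff_distrib[of "bernoulli_gf (x+1)"] bernoulli_gf_mult fps_exp_add_mult)
      (simp add: algebra_simps)
  then show ?thesis
    using fps_exp_1_minus_1_nonzero by simp
qed

lemma bernoulli_poly_plus_1:
  fixes x :: "'a::field_char_0"
  assumes "r \<ge> 1"
  shows "bernoulli_poly r (x + 1) - bernoulli_poly r x = of_nat r * x ^ (r - 1)"
proof -
  have "bernoulli_poly r (x + 1) - bernoulli_poly r x =
        fact r * fps_nth (bernoulli_gf (x + 1) - bernoulli_gf x) r"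
    by (simp add: bernoulli_poly_def algebra_simps)
  also have "\<dots> = fact r * (x ^ (r - 1) / fact (r - 1))"
    using assms by (simp add: bernoulli_gf_plus_1)
  also have "\<dots> = of_nat r * x ^ (r - 1)"
    using assms by (simp add: fact_reduce[of r])
  finally show ?thesis .
qed

lemma bernoulli_poly_0_plus_1: "bernoulli_poly 0 (x + 1) = bernoulli_poly 0 (x::'a::field_char_0)"
proof -
  have "fps_nth (bernoulli_gf (x + 1) - bernoulli_gf x) 0 = 0"
    by (simp add: bernoulli_gf_plus_1)
  then show ?thesis by (simp add: bernoulli_poly_def)
qed

lemma bernoulli_poly_0: "bernoulli_poly 0 (x::'a::field_char_0) = 1"
proof -
  have "fps_nth (bernoulli_gf x * (fps_exp 1 - 1)) 1 = fps_nth (fps_X * fps_exp x) 1"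
    by (simp only: bernoulli_gf_mult)
  then show ?thesis
    by (simp add: bernoulli_poly_def fps_mult_nth_1)
qed

text \<open>From \<open>B(2t) (e\<^sup>t + 1) = 2 B(t)\<close> for \<open>B(t) = t / (e\<^sup>t - 1)\<close>. Solving for \<open>B\<^sub>r\<close> divides by
  \<open>2(1 - 2\<^sup>r)\<close>, which unlike the factor \<open>r + 1\<close> of the usual recurrence has controlled 2-adic
  valuation.\<close>

lemma bernoulli_gf_double:
  "(bernoulli_gf 0 oo (fps_const 2 * fps_X)) * (fps_exp 1 + 1) =
    fps_const 2 * bernoulli_gf (0::'a::field_char_0)"
proof -
  let ?D = "bernoulli_gf (0::'a) oo (fps_const 2 * fps_X)"
  have "(bernoulli_gf (0::'a) * (fps_exp 1 - 1)) oo (fps_const 2 * fps_X) =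
        ?D * ((fps_exp 1 - 1) oo (fps_const 2 * fps_X))"
    by (rule fps_compose_mult_distrib) simp
  moreover have "(fps_exp 1 - 1 :: 'a fps) oo (fps_const 2 * fps_X) = fps_exp 2 - 1"
    by (simp add: fps_compose_sub_distrib fps_exp_compose_linear)
  ultimately have "?D * (fps_exp 2 - 1) = fps_const 2 * fps_X"
    by (simp add: bernoulli_gf_mult)
  moreover have "fps_exp (2::'a) = fps_exp 1 * fps_exp 1"
    using fps_exp_add_mult[of "1::'a" 1] by simp
  ultimately have "?D * (fps_exp 1 + 1) * (fps_exp 1 - 1) = fps_const 2 * fps_X"
    by (simp add: algebra_simps)
  also have "\<dots> = fps_const 2 * bernoulli_gf 0 * (fps_exp 1 - 1)"
    by (simp only: mult.assoc bernoulli_gf_mult) simp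
  finally show ?thesis
    using fps_exp_1_minus_1_nonzero by simp
qed

text \<open>Coefficient comparison in \<open>bernoulli_gf_double\<close>:
  \<open>2 ^ r * bernoulli_poly r 0\<close> arises twice on its left side, as the term
  \<open>k = r\<close> and from the summand 1.\<close>

lemma bernoulli_recurrence:
  "2 * (1 - 2 ^ r) * bernoulli_poly r (0::'a::field_char_0) =
    (\<Sum>k<r. of_nat (r choose k) * 2 ^ k * bernoulli_poly k 0)"
proof -
  have binom: "(of_nat (r choose k) :: 'a) = fact r / (fact k * fact (r - k))" if "k \<le> r" for k
    using that by (rule binomial_fact)
  have "fact r * fps_nth ((bernoulli_gf 0 oo (fps_const 2 * fps_X)) * (fps_exp 1 + 1)) r =
        fact r * fps_nth (fps_const 2 * bernoulli_gf (0::'a)) r"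
    by (simp only: bernoulli_gf_double)
  moreover have "fact r * fps_nth ((bernoulli_gf (0::'a) oo (fps_const 2 * fps_X)) * fps_exp 1) r =
      (\<Sum>k=0..r. of_nat (r choose k) * 2 ^ k * bernoulli_poly k 0)"
    unfolding fps_mult_nth sum_distrib_left fps_compose_linear
    by (intro sum.cong refl) (simp add: binom bernoulli_poly_def)
  moreover have "fact r * fps_nth (bernoulli_gf (0::'a) oo (fps_const 2 * fps_X)) r =
      2 ^ r * bernoulli_poly r 0"
    by (simp only: fps_compose_linear) (simp add: bernoulli_poly_def)
  moreover have "fact r * fps_nth (fps_const 2 * bernoulli_gf (0::'a)) r = 2 * bernoulli_poly r 0"
    by (simp add: bernoulli_poly_def)
  ultimately have "(\<Sum>k=0..r. of_nat (r choose k) * 2 ^ k * bernoulli_poly k (0::'a)) +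
      2 ^ r * bernoulli_poly r 0 = 2 * bernoulli_poly r 0"
    by (simp only: distrib_left mult_1_right fps_add_nth)
  moreover have "{0..r} = insert r {..<r}" by auto
  ultimately show ?thesis
    by (simp add: algebra_simps)
qed

section \<open>Rationals with odd denominator\<close>

text \<open>The localization of the integers at 2, that is, the rationals that are 2-adic
  integers.\<close>

definition odd_denom :: "rat set" where
  "odd_denom = {x. \<exists>m. odd m \<and> of_int m * x \<in> \<int>}"

lemma odd_denomI: "odd m \<Longrightarrow> of_int m * x \<in> \<int> \<Longrightarrow> x \<in> odd_denom"
  by (auto simp: odd_denom_def)

lemma odd_denomE:
  assumes "x \<in> odd_denom"
  obtains m where "odd m" "of_int m * x \<in> \<int>"
  using assms by (auto simp: odd_denom_def)

lemma odd_denom_Ints: "x \<in> \<int> \<Longrightarrow> x \<in> odd_denom"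
  by (rule odd_denomI[of 1]) auto

lemma odd_denom_add:
  assumes "x \<in> odd_denom" "y \<in> odd_denom"
  shows "x + y \<in> odd_denom"
proof -
  obtain a b where "odd a" "of_int a * x \<in> \<int>" "odd b" "of_int b * y \<in> \<int>"
    using assms by (metis odd_denomE)
  moreover have "of_int (a * b) * (x + y) = of_int b * (of_int a * x) + of_int a * (of_int b * y)"
    by (simp add: algebra_simps)
  ultimately show ?thesis
    by (metis Ints_add Ints_mult Ints_of_int even_mult_iff odd_denomI)
qed

lemma odd_denom_mult:
  assumes "x \<in> odd_denom" "y \<in> odd_denom"
  shows "x * y \<in> odd_denom"
proof -
  obtain a b where "odd a" "of_int a * x \<in> \<int>" "odd b" "of_int b * y \<in> \<int>"
    using assms by (metis odd_denomE)
  moreover have "of_int (a * b) * (x * y) = (of_int a * x) * (of_int b * y)"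
    by (simp add: algebra_simps)
  ultimately show ?thesis
    by (metis Ints_mult even_mult_iff odd_denomI)
qed

lemma odd_denom_diff:
  assumes "x \<in> odd_denom" "y \<in> odd_denom"
  shows "x - y \<in> odd_denom"
  using odd_denom_add[OF assms(1) odd_denom_mult[OF odd_denom_Ints[of "-1"] assms(2)]] by simp

lemma odd_denom_sum: "(\<And>a. a \<in> A \<Longrightarrow> f a \<in> odd_denom) \<Longrightarrow> sum f A \<in> odd_denom"
  by (induction A rule: infinite_finite_induct) (auto intro: odd_denom_add odd_denom_Ints)

text \<open>Odd integers are units of this ring; this permits division by \<open>1 - 2 ^ r\<close>
  in the Bernoulli recurrence.\<close>

lemma odd_denom_cancel:
  assumes "odd m" "of_int m * x \<in> odd_denom"
  shows "x \<in> odd_denom"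
proof -
  obtain a where "odd a" "of_int a * (of_int m * x) \<in> \<int>"
    using assms by (metis odd_denomE)
  then show ?thesis
    using assms(1) odd_denomI[of "a * m" x] by (simp add: mult.assoc)
qed

lemma half_odd_notin_odd_denom:
  assumes "odd s"
  shows "of_int s / 2 \<notin> odd_denom"
proof
  assume "of_int s / 2 \<in> odd_denom"
  then obtain m k where "odd m" "of_int m * (of_int s / 2) = (of_int k :: rat)"
    by (metis odd_denomE Ints_cases)
  then have "(of_int (m * s) :: rat) = of_int (2 * k)"
    by simp
  then have "m * s = 2 * k"
    by (simp only: of_int_eq_iff)
  then show False
    using assms \<open>odd m\<close> by (metis dvd_triv_left even_mult_iff)
qed

text \<open>The case \<open>p = 2\<close> of the von Staudt--Clausen theorem: \<open>2B\<^sub>r \<equiv> r + 1 (mod 2)\<close> for \<open>r \<ge> 2\<close>.\<close>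

definition bernoulli_parity :: "nat \<Rightarrow> nat" where
  "bernoulli_parity r = (if r = 1 then 1 else r + 1)"

lemma two_bernoulli_mod_2:
  assumes "r \<ge> 1"
  shows "bernoulli_poly r 0 - of_nat (bernoulli_parity r) / 2 \<in> odd_denom"
  using assms
proof (induction r rule: less_induct)
  case (less r)
  define b :: "nat \<Rightarrow> rat" where "b k = bernoulli_poly k 0" for k
  have b1: "b 1 = - 1 / 2"
    using bernoulli_recurrence[of 1, where 'a=rat] by (simp add: b_def bernoulli_poly_0)
  show ?case
  proof (cases "r = 1")
    case True
    then show ?thesis
      using b1 by (simp add: b_def bernoulli_parity_def odd_denom_Ints)
  next
    case False
    with less have r: "r \<ge> 2" by simp
    have "{..<r} = insert 0 (insert 1 {2..<r})"
      using r by auto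
    \<comment> \<open>The terms \<open>k = 0\<close> and \<open>k = 1\<close> give 1 and
      \<open>- of_nat r\<close>, because \<open>b 1 = - 1 / 2\<close>.\<close>
    then have rec: "2 * (1 - 2 ^ r) * b r =
        1 - of_nat r + (\<Sum>k=2..<r. of_nat (r choose k) * 2 ^ k * b k)"
      using bernoulli_recurrence[of r, where 'a=rat] b1[unfolded b_def]
      by (simp add: b_def bernoulli_poly_0)
    \<comment> \<open>For \<open>k \<ge> 2\<close> the power \<open>2 ^ k\<close> has two factors 2
      to spare: one for the halving, one to make \<open>2 * b k\<close> a 2-adic integer by
      induction.\<close>
    have "(\<Sum>k=2..<r. of_nat (r choose k) * 2 ^ k * b k) / 2 =
        (\<Sum>k=2..<r. of_nat (r choose k) * (2 ^ (k - 2) * (2 * b k)))"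
      unfolding sum_divide_distrib
    proof (intro sum.cong refl)
      fix k assume "k \<in> {2..<r}"
      then obtain l where "k = l + 2" by (metis add.commute atLeastLessThan_iff le_Suc_ex)
      then show "of_nat (r choose k) * 2 ^ k * b k / 2 =
          of_nat (r choose k) * (2 ^ (k - 2) * (2 * b k))"
        by simp
    qed
    also have "\<dots> \<in> odd_denom"
    proof (rule odd_denom_sum)
      fix k assume k: "k \<in> {2..<r}"
      have "2 * (b k - of_nat (bernoulli_parity k) / 2) + of_nat (bernoulli_parity k) \<in> odd_denom"
        using k less.IH[of k] unfolding b_def
        by (intro odd_denom_add odd_denom_mult[of 2]) (auto intro: odd_denom_Ints)
      then have "2 * b k \<in> odd_denom" by (simp add: algebra_simps)
      then show "of_nat (r choose k) * (2 ^ (k - 2) * (2 * b k)) \<in> odd_denom"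
        by (intro odd_denom_mult[of "of_nat _"] odd_denom_mult[of "2 ^ _"]) (auto intro: odd_denom_Ints)
    qed
    finally have sum: "(\<Sum>k=2..<r. of_nat (r choose k) * 2 ^ k * b k) / 2 \<in> odd_denom" .
    have "2 ^ r = 2 * (2 ^ (r - 1) :: rat)"
      using r by (metis One_nat_def Suc_1 Suc_le_D diff_Suc_1 power_Suc)
    then have "of_int (1 - 2 ^ r) * (b r - of_nat (bernoulli_parity r) / 2) =
        (\<Sum>k=2..<r. of_nat (r choose k) * 2 ^ k * b k) / 2
          + (2 ^ (r - 1) * of_nat (r + 1) - of_nat r)"
      using rec r by (simp add: bernoulli_parity_def field_simps)
    also have "\<dots> \<in> odd_denom"
      by (intro odd_denom_add sum odd_denom_Ints) auto
    finally show ?thesis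
      unfolding b_def by (rule odd_denom_cancel[rotated]) (use r in simp)
  qed
qed

section \<open>Parity of the binomial coefficients\<close>

text \<open>By absorption \<open>k * (m choose k) = m * ((m - 1) choose (k - 1))\<close>, where the
  odd \<open>k\<close> cannot supply the factor 2.\<close>

lemma even_binomial_even_odd:
  assumes "even m" "odd k"
  shows "even (m choose k)"
proof (cases m)
  case (Suc l)
  moreover obtain i where "k = Suc i" using assms(2) by (cases k) auto
  ultimately show ?thesis
    using Suc_times_binomial_eq[of l i] assms by (metis even_mult_iff)
qed (use assms in \<open>auto elim: oddE\<close>)

text \<open>What remains of \<open>2 * r * ((n + r) choose (2 * r))\<close> after division by
  \<open>n + r\<close>; the natural subtractions are meant for \<open>r \<ge> 1\<close>.\<close>

definition zagier_coeff :: "nat \<Rightarrow> nat \<Rightarrow> nat" where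
  "zagier_coeff n r = (n + r - 1) choose (2 * r - 1)"

lemma even_zagier_coeff: "r \<ge> 1 \<Longrightarrow> odd (n + r) \<Longrightarrow> even (zagier_coeff n r)"
  unfolding zagier_coeff_def by (rule even_binomial_even_odd) auto

text \<open>Substituting \<open>k = n - r\<close> gives a shallow diagonal of Pascal's
  triangle.\<close>

lemma sum_zagier_coeff:
  assumes "n \<ge> 1"
  shows "(\<Sum>r=1..n. zagier_coeff n r) = fib (2 * n)"
proof -
  have "fib (2 * n) = (\<Sum>k\<le>2 * n - 1. (2 * n - 1 - k) choose k)"
    using ne_diagonal_fib[of "2 * n - 1"] assms by (simp add: atMost_atLeast0)
  \<comment> \<open>Terms with \<open>k \<ge> n\<close> vanish, as then
    \<open>2 * n - 1 - k < k\<close>.\<close>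
  also have "\<dots> = (\<Sum>k<n. (2 * n - 1 - k) choose k)"
    by (rule sum.mono_neutral_right) (use assms in \<open>auto intro!: binomial_eq_0\<close>)
  also have "\<dots> = (\<Sum>r=1..n. zagier_coeff n r)"
  proof (rule sum.reindex_bij_witness[of _ "\<lambda>r. n - r" "\<lambda>k. n - k"])
    fix k assume k: "k \<in> {..<n}"
    then have "k \<le> 2 * n - 1 - k" "2 * n - 1 - k - k = 2 * (n - k) - 1" "n + (n - k) - 1 = 2 * n - 1 - k"
      by auto
    then show "zagier_coeff n (n - k) = (2 * n - 1 - k) choose k"
      using binomial_symmetric[of k "2 * n - 1 - k"] by (simp only: zagier_coeff_def)
  qed auto
  finally show ?thesis ..
qed

lemma even_fib_iff: "even (fib n) \<longleftrightarrow> 3 dvd n"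
proof (induction n rule: fib.induct)
  case (3 n)
  then have "even (fib (Suc (Suc n))) \<longleftrightarrow> (3 dvd Suc n \<longleftrightarrow> 3 dvd n)"
    by simp
  then show ?case by presburger
qed auto

text \<open>For odd \<open>n\<close>, only \<open>r = 1\<close> counts modulo 2: even
  \<open>r\<close> have even coefficients and odd \<open>r \<ge> 3\<close> have even parity weight.
  For even \<open>n\<close>, the weight is odd wherever the coefficient can be odd, so the sum has
  the parity of \<open>fib (2 * n)\<close>.\<close>

lemma odd_sum_zagier_coeff_parity:
  assumes "n \<ge> 1" "\<not> 6 dvd n"
  shows "odd (\<Sum>r=1..n. zagier_coeff n r * bernoulli_parity r)"
proof (cases "odd n")
  case True
  have "{1..n} = insert 1 {2..n}" using assms by auto
  moreover have "even (\<Sum>r=2..n. zagier_coeff n r * bernoulli_parity r)"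
    using True even_zagier_coeff[of _ n] by (intro dvd_sum) (auto simp: bernoulli_parity_def)
  moreover have "zagier_coeff n 1 * bernoulli_parity 1 = n"
    by (simp add: zagier_coeff_def bernoulli_parity_def)
  ultimately show ?thesis
    using True by (simp del: One_nat_def)
next
  case False
  have "even (zagier_coeff n r * bernoulli_parity r) \<longleftrightarrow> even (zagier_coeff n r)"
    if "r \<in> {1..n}" for r
    using that False even_zagier_coeff[of r n] by (auto simp: bernoulli_parity_def)
  then have "even (\<Sum>r=1..n. zagier_coeff n r * bernoulli_parity r) \<longleftrightarrow>
      even (\<Sum>r=1..n. zagier_coeff n r)"
    by (simp add: even_sum_iff cong: conj_cong del: One_nat_def even_mult_iff)
  moreover have "\<not> 3 dvd 2 * n"
    using assms(2) False by presburger
  ultimately show ?thesis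
    unfolding sum_zagier_coeff[OF assms(1)] even_fib_iff by blast
qed

lemma even_sum_zagier_coeff_power:
  assumes "n \<ge> 1" "6 dvd n"
  shows "even (\<Sum>r=1..n. int (zagier_coeff n r) * j ^ (r - 1))"
proof (cases "even j")
  case True
  \<comment> \<open>The term \<open>r = 1\<close> equals \<open>n\<close>, since
    \<open>j ^ 0 = 1\<close>; all others contain the even factor \<open>j\<close>.\<close>
  have "even (int (zagier_coeff n r) * j ^ (r - 1))" if "r \<in> {1..n}" for r
  proof (cases "r = 1")
    case True
    then show ?thesis
      using assms(2) by (auto simp: zagier_coeff_def)
  qed (use that \<open>even j\<close> in auto)
  then show ?thesis by (rule dvd_sum)
next
  case False
  then have "even (\<Sum>r=1..n. int (zagier_coeff n r) * j ^ (r - 1)) \<longleftrightarrow>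
      even (\<Sum>r=1..n. zagier_coeff n r)"
    by (simp add: even_sum_iff)
  moreover have "3 dvd 2 * n"
    using assms(2) by presburger
  ultimately show ?thesis
    unfolding sum_zagier_coeff[OF assms(1)] even_fib_iff by blast
qed

section \<open>Zagier polynomials\<close>

lemma zagier_coeff_absorb:
  assumes "r \<ge> 1"
  shows "2 * r * ((n + r) choose (2 * r)) = (n + r) * zagier_coeff n r"
proof -
  obtain a b where "n + r = Suc a" "2 * r = Suc b"
    using assms by (metis add_gr_0 gr0_conv_Suc less_eq_Suc_le One_nat_def mult_2)
  then show ?thesis
    using Suc_times_binomial_eq[of a b] by (simp add: zagier_coeff_def mult.commute)
qed

lemma zagier_poly_plus_1:
  fixes x :: "'a::field_char_0"
  shows "2 * (zagier_poly n (x + 1) - zagier_poly n x) =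
    (\<Sum>r=1..n. of_nat (zagier_coeff n r) * x ^ (r - 1))"
proof -
  have "2 * (zagier_poly n (x + 1) - zagier_poly n x) = (\<Sum>r=0..n. 2 * of_nat ((n + r) choose (2 * r)) *
      ((bernoulli_poly r (x + 1) - bernoulli_poly r x) / of_nat (n + r)))"
    by (simp add: zagier_poly_def sum_subtractf[symmetric] sum_distrib_left diff_divide_distrib
        algebra_simps)
  also have "\<dots> = (\<Sum>r=1..n. 2 * of_nat ((n + r) choose (2 * r)) *
      ((bernoulli_poly r (x + 1) - bernoulli_poly r x) / of_nat (n + r)))"
    by (rule sum.mono_neutral_right) (auto simp: bernoulli_poly_0_plus_1 not_less_eq_eq)
  also have "\<dots> = (\<Sum>r=1..n. of_nat (zagier_coeff n r) * x ^ (r - 1))"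
  proof (rule sum.cong[OF refl])
    fix r assume r: "r \<in> {1..n}"
    have "of_nat (2 * r * ((n + r) choose (2 * r))) = (of_nat ((n + r) * zagier_coeff n r) :: 'a)"
      using r by (subst zagier_coeff_absorb) auto
    then have c: "2 * of_nat r * of_nat ((n + r) choose (2 * r)) =
        (of_nat (n + r) * of_nat (zagier_coeff n r) :: 'a)"
      by (simp only: of_nat_mult of_nat_numeral)
    have nz: "of_nat (n + r) \<noteq> (0 :: 'a)"
      using r by (simp only: of_nat_eq_0_iff) auto
    have "2 * of_nat ((n + r) choose (2 * r)) *
        ((bernoulli_poly r (x + 1) - bernoulli_poly r x) / of_nat (n + r)) =
        2 * of_nat r * of_nat ((n + r) choose (2 * r)) * x ^ (r - 1) / of_nat (n + r)"
      using r by (simp add: bernoulli_poly_plus_1 mult_ac)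
    also have "\<dots> = of_nat (zagier_coeff n r) * x ^ (r - 1)"
      unfolding c by (simp only: mult.assoc nonzero_mult_div_cancel_left[OF nz])
    finally show "2 * of_nat ((n + r) choose (2 * r)) *
        ((bernoulli_poly r (x + 1) - bernoulli_poly r x) / of_nat (n + r)) =
        of_nat (zagier_coeff n r) * x ^ (r - 1)" .
  qed
  finally show ?thesis .
qed

text \<open>Unit steps telescope from 0 in both directions. The modulus \<open>m\<close> is later
  taken as 2 if 6 divides \<open>n\<close>, and as 1 otherwise.\<close>

lemma zagier_poly_diff:
  fixes m :: int
  assumes "\<And>k::int. m dvd (\<Sum>r=1..n. int (zagier_coeff n r) * k ^ (r - 1))"
  shows "\<exists>c::int. 2 * (zagier_poly n (of_int j) - zagier_poly n 0) = (of_int (m * c) :: rat)"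
proof (induction j rule: int_induct[where k=0])
  case base
  show ?case by (rule exI[of _ 0]) simp
next
  case (step1 j)
  obtain d where "(\<Sum>r=1..n. int (zagier_coeff n r) * j ^ (r - 1)) = m * d"
    using assms[of j] by auto
  moreover have "2 * (zagier_poly n (of_int j + 1) - zagier_poly n (of_int j)) =
      (of_int (\<Sum>r=1..n. int (zagier_coeff n r) * j ^ (r - 1)) :: rat)"
    by (simp only: zagier_poly_plus_1) simp
  ultimately have d: "2 * (zagier_poly n (of_int j + 1) - zagier_poly n (of_int j)) =
      (of_int (m * d) :: rat)"
    by simp
  from step1 obtain c where "2 * (zagier_poly n (of_int j) - zagier_poly n 0) = (of_int (m * c) :: rat)"
    by blast
  then show ?case
    using d by (intro exI[of _ "c + d"]) (simp add: algebra_simps)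
next
  case (step2 j)
  obtain d where "(\<Sum>r=1..n. int (zagier_coeff n r) * (j - 1) ^ (r - 1)) = m * d"
    using assms[of "j - 1"] by auto
  moreover have "2 * (zagier_poly n (of_int (j - 1) + 1) - zagier_poly n (of_int (j - 1))) =
      (of_int (\<Sum>r=1..n. int (zagier_coeff n r) * (j - 1) ^ (r - 1)) :: rat)"
    by (simp only: zagier_poly_plus_1) simp
  ultimately have d: "2 * (zagier_poly n (of_int j) - zagier_poly n (of_int (j - 1))) =
      (of_int (m * d) :: rat)"
    by simp
  from step2 obtain c where "2 * (zagier_poly n (of_int j) - zagier_poly n 0) = (of_int (m * c) :: rat)"
    by blast
  then show ?case
    using d by (intro exI[of _ "c - d"]) (simp add: algebra_simps)
qed

text \<open>The coefficient \<open>2n (n+r choose 2r) / (n+r)\<close> is written as an integer whose residue modulo 2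
  can be read off.\<close>

lemma zagier_poly_scaled:
  assumes "n \<ge> 1"
  shows "2 * of_nat n * zagier_poly n (x::'a::field_char_0) = 2 +
    (\<Sum>r=1..n. (2 * of_nat ((n + r) choose (2 * r)) - of_nat (zagier_coeff n r)) * bernoulli_poly r x)"
proof -
  have "{0..n} = insert 0 {1..n}" by auto
  then have "2 * of_nat n * zagier_poly n x = 2 +
      (\<Sum>r=1..n. 2 * of_nat n * (of_nat ((n + r) choose (2 * r)) * (bernoulli_poly r x / of_nat (n + r))))"
    using assms by (simp add: zagier_poly_def bernoulli_poly_0 distrib_left sum_distrib_left)
  also have "(\<Sum>r=1..n. 2 * of_nat n * (of_nat ((n + r) choose (2 * r)) * (bernoulli_poly r x / of_nat (n + r)))) =
    (\<Sum>r=1..n. (2 * of_nat ((n + r) choose (2 * r)) - of_nat (zagier_coeff n r)) * bernoulli_poly r x)"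
  proof (rule sum.cong[OF refl])
    fix r assume r: "r \<in> {1..n}"
    have "of_nat (2 * r * ((n + r) choose (2 * r))) = (of_nat ((n + r) * zagier_coeff n r) :: 'a)"
      using r by (subst zagier_coeff_absorb) auto
    then have "2 * of_nat r * of_nat ((n + r) choose (2 * r)) =
        ((of_nat n + of_nat r) * of_nat (zagier_coeff n r) :: 'a)"
      by (simp only: of_nat_mult of_nat_numeral of_nat_add)
    then have c: "2 * of_nat n * of_nat ((n + r) choose (2 * r)) = (of_nat n + of_nat r) *
        (2 * of_nat ((n + r) choose (2 * r)) - of_nat (zagier_coeff n r) :: 'a)"
      by (simp add: algebra_simps)
    have nz: "of_nat n + of_nat r \<noteq> (0 :: 'a)"
      using r by (simp only: of_nat_eq_0_iff of_nat_add[symmetric]) auto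
    have "2 * of_nat n * (of_nat ((n + r) choose (2 * r)) * (bernoulli_poly r x / of_nat (n + r))) =
        2 * of_nat n * of_nat ((n + r) choose (2 * r)) * bernoulli_poly r x / (of_nat n + of_nat r)"
      by simp
    also have "\<dots> =
        (2 * of_nat ((n + r) choose (2 * r)) - of_nat (zagier_coeff n r)) * bernoulli_poly r x"
      unfolding c using nz by simp
    finally show "2 * of_nat n *
        (of_nat ((n + r) choose (2 * r)) * (bernoulli_poly r x / of_nat (n + r))) =
        (2 * of_nat ((n + r) choose (2 * r)) - of_nat (zagier_coeff n r)) * bernoulli_poly r x" .
  qed
  finally show ?thesis .
qed

text \<open>Modulo 2-adic integers each Bernoulli number is half its parity weight, so the scaled
  value is \<open>- S / 2\<close> for the odd sum \<open>S\<close> of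
  \<open>odd_sum_zagier_coeff_parity\<close>.\<close>

lemma zagier_poly_scaled_notin_odd_denom:
  assumes "n \<ge> 1" "\<not> 6 dvd n"
  shows "2 * of_nat n * zagier_poly n 0 \<notin> odd_denom"
proof
  assume *: "2 * of_nat n * zagier_poly n 0 \<in> odd_denom"
  define S where "S = (\<Sum>r=1..n. zagier_coeff n r * bernoulli_parity r)"
  define c :: "nat \<Rightarrow> rat" where
    "c r = 2 * of_nat ((n + r) choose (2 * r)) - of_nat (zagier_coeff n r)" for r
  define e :: "nat \<Rightarrow> rat" where "e r = bernoulli_poly r 0 - of_nat (bernoulli_parity r) / 2" for r
  have "of_int (int S) / 2 = (\<Sum>r=1..n. of_nat (zagier_coeff n r) * (of_nat (bernoulli_parity r) / 2 :: rat))"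
    by (simp add: S_def sum_divide_distrib)
  also have "\<dots> = (\<Sum>r=1..n. c r * e r + of_nat (((n + r) choose (2 * r)) * bernoulli_parity r)
      - c r * bernoulli_poly r 0)"
    by (intro sum.cong refl) (simp add: c_def e_def field_simps)
  also have "\<dots> + 2 * of_nat n * zagier_poly n 0 =
      (\<Sum>r=1..n. c r * e r + of_nat (((n + r) choose (2 * r)) * bernoulli_parity r)) + 2"
    using zagier_poly_scaled[OF assms(1), of "0::rat"] by (simp add: sum_subtractf c_def)
  finally have "of_int (int S) / 2 = (\<Sum>r=1..n. c r * e r + of_nat (((n + r) choose (2 * r)) * bernoulli_parity r))
      + 2 - 2 * of_nat n * zagier_poly n 0"
    by (simp add: algebra_simps)
  also have "\<dots> \<in> odd_denom"
    by (intro odd_denom_diff odd_denom_add odd_denom_sum odd_denom_mult *)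
      (auto simp: c_def e_def intro!: odd_denom_Ints two_bernoulli_mod_2)
  finally show False
    using half_odd_notin_odd_denom[of "int S"] odd_sum_zagier_coeff_parity[OF assms, folded S_def]
    by (metis even_of_nat)
qed

section \<open>Denominators\<close>

text \<open>The new numerator \<open>p + k * m\<close> is coprime to \<open>m\<close> because
  \<open>p\<close> is, hence to \<open>m ^ 2\<close> and to its divisor \<open>q\<close>: the
  fraction is still reduced.\<close>

lemma denom_eqI:
  assumes "quotient_of x = (p, q)" "m dvd q" "q dvd m ^ 2"
    and "y = x + of_int (k * m) / of_int q"
  shows "snd (quotient_of y) = q"
proof -
  have q: "q > 0" "coprime p q" "x = of_int p / of_int q"
    using assms(1) quotient_of_denom_pos quotient_of_coprime quotient_of_div by auto
  have "coprime p m"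
    using q(2) assms(2) by (metis coprime_divisors dvd_refl)
  then have "coprime (p + k * m) m"
    by (metis coprime_iff_gcd_eq_1 gcd_add_mult add.commute gcd.commute)
  then have "coprime (p + k * m) q"
    using assms(3) by (metis coprime_divisors coprime_power_right_iff dvd_refl)
  moreover have "y = Fract (p + k * m) q"
    using assms(4) q by (simp add: Fract_of_int_quotient add_divide_distrib)
  ultimately show ?thesis
    using q(1) by (simp add: quotient_of_Fract normalize_stable)
qed

lemma four_dvd_denom:
  assumes "2 * of_nat n * x \<notin> odd_denom"
  shows "4 dvd snd (quotient_of x)"
proof (rule ccontr)
  obtain p q where pq: "quotient_of x = (p, q)" by fastforce
  then have q: "q > 0" "x = of_int p / of_int q"
    using quotient_of_denom_pos quotient_of_div by auto
  assume "\<not> 4 dvd snd (quotient_of x)"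
  then have "\<not> 4 dvd q" using pq by simp
  \<comment> \<open>If 4 does not divide \<open>q\<close>, then \<open>q\<close> divides twice an
    odd number \<open>m\<close>; so multiplying \<open>2 * of_nat n * x\<close> by \<open>m\<close>
    clears the denominator.\<close>
  obtain m d where m: "odd m" "2 * m = q * d"
  proof (cases "even q")
    case True
    then obtain l where "q = 2 * l" ..
    then show ?thesis
      using that[of l 1] \<open>\<not> 4 dvd q\<close> mult_dvd_mono[of 2 2 2 l] by auto
  next
    case False
    then show ?thesis
      using that[of q 2] by simp
  qed
  have "of_int m * (2 * of_nat n * x) = of_int (2 * m) * of_nat n * x" by simp
  also have "\<dots> = of_int (d * int n * p)"
    using q by (simp add: m(2))
  also have "\<dots> \<in> \<int>" by simp
  finally show False
    using assms m(1) odd_denomI by blast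
qed

theorem theorem1p3:
  fixes n :: nat and i j :: int
  assumes "n \<ge> 1"
  shows "zagier_denom n i = zagier_denom n j"
proof -
  obtain p q where pq: "quotient_of (zagier_poly n 0) = (p, q)" by fastforce
  then have q: "q > 0" by (rule quotient_of_denom_pos)
  have "zagier_denom n k = q" for k
  proof (cases "6 dvd n")
    case True
    then obtain c where "2 * (zagier_poly n (of_int k) - zagier_poly n 0) = (of_int (2 * c) :: rat)"
      using zagier_poly_diff[of 2 n k] even_sum_zagier_coeff_power[OF assms] by blast
    \<comment> \<open>The integer shift \<open>c\<close> is written over \<open>q\<close> to apply
      \<open>denom_eqI\<close> with \<open>m = q\<close>.\<close>
    then have "zagier_poly n (of_int k) = zagier_poly n 0 + (of_int (c * q) / of_int q :: rat)"
      using q by (simp add: algebra_simps)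
    then show ?thesis
      unfolding zagier_denom_def by (intro denom_eqI[OF pq, of q]) (auto simp: power2_eq_square)
  next
    case False
    then have "4 dvd q"
      using four_dvd_denom[OF zagier_poly_scaled_notin_odd_denom[OF assms]] pq by simp
    then obtain l where l: "q = 4 * l" ..
    obtain c where "2 * (zagier_poly n (of_int k) - zagier_poly n 0) = (of_int (1 * c) :: rat)"
      using zagier_poly_diff[of 1 n k] by auto
    \<comment> \<open>The shift \<open>c / 2\<close> has numerator \<open>c * (2 * l)\<close> over
      \<open>q\<close>; \<open>denom_eqI\<close> applies because \<open>q = 4 * l\<close> divides
      \<open>(2 * l) ^ 2\<close>.\<close>
    then have "zagier_poly n (of_int k) = zagier_poly n 0 + (of_int (c * (2 * l)) / of_int q :: rat)"
      using q l by (simp add: field_simps)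
    then show ?thesis
      unfolding zagier_denom_def
      by (intro denom_eqI[OF pq, of "2 * l"]) (auto simp: l power2_eq_square)
  qed
  then show ?thesis by simp
qed

end
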